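(* $\Delta(1,2,2)$ is not a hero in orientations of chordal graphs; that is, for every integer $k$ there exists an orientation of a chordal graph containing no induced copy of $\Delta(1,2,2)$ and having dichromatic number greater than $k$.
   Context: All digraphs are finite and simple (no loops, no parallel arcs, no digons). An orientation of a chordal graph is a digraph whose underlying undirected graph has no induced cycle of length at least $4$. The dichromatic number of a digraph is the least $k$ such that its vertex set can be partitioned into $k$ sets each inducing an acyclic subdigraph. A digraph $H$ is a hero in a hereditary class $\mathcal{C}$ if the digraphs in $\mathcal{C}$ with no induced copy of $H$ have bounded dichromatic number. $TT_2$ is the tournament on two vertices (a single arc). $\Delta(1,2,2)$ is the tournament on $5$ vertices obtained from a vertex $x$ and two disjoint copies $A$, $B$ of $TT_2$ by adding all arcs from $x$ to $A$, all arcs from $A$ to $B$, and all arcs from $B$ to $x$. *)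

theory Defs
  imports "Graph_Theory.Graph_Theory"
begin

locale simple_digraph = digraph +
  assumes no_digons: "(u, v) \<in> arcs_ends G \<Longrightarrow> (v, u) \<notin> arcs_ends G"

text \<open>The library represents undirected graphs as symmetric digraphs (locale \<^locale>\<open>graph\<close>).
  Accordingly the undirected cycle below carries both arcs of every edge.
  It is only meant for \<open>n \<ge> 3\<close>.\<close>

definition cycle_graph :: "nat \<Rightarrow> nat pair_pre_digraph" where
  "cycle_graph n = \<lparr> pverts = {..<n},
     parcs = {(i, j). i < n \<and> j < n \<and> (j = Suc i mod n \<or> i = Suc j mod n)} \<rparr>"

definition has_induced_copy :: "('a, 'b) pre_digraph \<Rightarrow> ('c, 'd) pre_digraph \<Rightarrow> bool" where
  "has_induced_copy G H \<longleftrightarrow> (\<exists>K. induced_subgraph K G \<and> digraph_iso K H)"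

definition chordal_graph :: "('a, 'b) pre_digraph \<Rightarrow> bool" where
  "chordal_graph U \<longleftrightarrow>
     graph U \<and> \<not> (\<exists>n\<ge>4. has_induced_copy U (with_proj (cycle_graph n)))"

definition chordal_orientation :: "('a, 'b) pre_digraph \<Rightarrow> bool" where
  "chordal_orientation G \<longleftrightarrow> simple_digraph G \<and> chordal_graph (with_proj (mk_symmetric G))"

definition acyclic_digraph :: "('a, 'b) pre_digraph \<Rightarrow> bool" where
  "acyclic_digraph G \<longleftrightarrow> \<not> (\<exists>p. pre_digraph.cycle G p)"

text \<open>The parts of \<^const>\<open>partition_on\<close> are nonempty, which does not affect the minimum.
  For a finite loopless digraph the partition into singletons shows that the minimum exists.\<close>

definition dichromatic_number :: "('a, 'b) pre_digraph \<Rightarrow> nat" where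
  "dichromatic_number G = (LEAST k. \<exists>P. partition_on (verts G) P \<and> finite P \<and> card P = k \<and>
     (\<forall>S\<in>P. acyclic_digraph (G \<restriction> S)))"

text \<open>The notion is used for hereditary classes \<open>C\<close> of finite digraphs. Up to isomorphism, every
  finite simple digraph has vertices in \<^typ>\<open>nat\<close> and arcs in \<^typ>\<open>nat \<times> nat\<close>, so
  classes over these types are fully general.\<close>

definition hero_in :: "('c, 'd) pre_digraph \<Rightarrow> ('a, 'b) pre_digraph set \<Rightarrow> bool" where
  "hero_in H C \<longleftrightarrow>
     (\<exists>k. \<forall>G\<in>C. \<not> has_induced_copy G H \<longrightarrow> dichromatic_number G \<le> k)"

text \<open>The vertex \<open>x\<close> is \<open>0\<close>, and the two copies of the single arc live on \<open>{1, 2}\<close> and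
  \<open>{3, 4}\<close>.\<close>

definition Delta_1_2_2 :: "nat pair_pre_digraph" where
  "Delta_1_2_2 = \<lparr> pverts = {0} \<union> {1, 2} \<union> {3, 4},
     parcs = {(1, 2)} \<union> {(3, 4)} \<union> {0} \<times> {1, 2} \<union> {1, 2} \<times> {3, 4} \<union> {3, 4} \<times> {0} \<rparr>"

end

theory Submission
  imports Defs
begin

text \<open>Write \<open>D\<^sub>k\<close> for a \<open>\<Delta>(1,2,2)\<close>-free orientation of a chordal graph in which
  every colouring with at most \<open>k\<close> colours has a monochromatic cyclic triangle. Take a
  transitive tournament on \<open>k + 2\<close> vertices, and for each of its arcs \<open>(u, v)\<close> add a
  copy of \<open>D\<^sub>k\<close> with all arcs from \<open>v\<close> to the copy and from the copy to \<open>u\<close>.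
  With \<open>k + 1\<close> colours some arc \<open>(u, v)\<close> has both ends of the same colour; either its copy uses
  that colour, which gives a cyclic triangle, or the copy only has \<open>k\<close> colours. The underlying
  graph stays chordal since copies are glued along cliques, and no \<open>\<Delta>(1,2,2)\<close> arises: inside the
  union of a copy with \<open>{u, v}\<close>, the only possible in-neighbour of \<open>v\<close> is \<open>u\<close> and the only possible
  out-neighbour of \<open>u\<close> is \<open>v\<close>, whereas \<open>\<Delta>(1,2,2)\<close> has no source, no sink, and no arc from a
  vertex of out-degree 1 to a vertex of in-degree 1.\<close>

section \<open>Orientations on initial segments of the naturals, and the gluing step\<close>

definition adjacent :: "'a rel \<Rightarrow> 'a \<Rightarrow> 'a \<Rightarrow> bool" where
  "adjacent R a b \<longleftrightarrow> (a, b) \<in> R \<or> (b, a) \<in> R"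

text \<open>Any two of the five vertices are joined by one of these ten arcs, so in an asymmetric
  \<open>R\<close> the arcs alone force the vertices to be distinct and the copy to be
  induced.\<close>

definition delta_in :: "'a rel \<Rightarrow> 'a \<Rightarrow> 'a \<Rightarrow> 'a \<Rightarrow> 'a \<Rightarrow> 'a \<Rightarrow> bool" where
  "delta_in R x a a' b b' \<longleftrightarrow> {(a, a'), (b, b'), (x, a), (x, a'), (a, b), (a, b'),
     (a', b), (a', b'), (b, x), (b', x)} \<subseteq> R"

definition mono_triangle :: "'a rel \<Rightarrow> ('a \<Rightarrow> 'c) \<Rightarrow> bool" where
  "mono_triangle R f \<longleftrightarrow>
     (\<exists>a b c. (a, b) \<in> R \<and> (b, c) \<in> R \<and> (c, a) \<in> R \<and> f a = f b \<and> f b = f c)"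

text \<open>The third condition says that the reverse of the order of the naturals is a perfect
  elimination ordering, which makes the underlying graph chordal.\<close>

definition elimination_orientation :: "nat \<Rightarrow> nat rel \<Rightarrow> bool" where
  "elimination_orientation n R \<longleftrightarrow> R \<subseteq> {..<n} \<times> {..<n} \<and> (\<forall>a b. (a, b) \<in> R \<longrightarrow> (b, a) \<notin> R) \<and>
     (\<forall>a b c. a < c \<longrightarrow> b < c \<longrightarrow> a \<noteq> b \<longrightarrow> adjacent R a c \<longrightarrow> adjacent R b c \<longrightarrow> adjacent R a b)"

text \<open>The copy of \<open>S\<close> is shifted to the numbers from \<open>n\<close> on, above
  all old vertices, so that it comes before them in the elimination ordering.\<close>

definition glue :: "nat \<Rightarrow> nat rel \<Rightarrow> nat \<Rightarrow> nat \<Rightarrow> nat \<Rightarrow> nat rel \<Rightarrow> nat rel" where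
  "glue n R u v m S = R \<union> (\<lambda>(a, b). (n + a, n + b)) ` S
     \<union> {v} \<times> {n..<n + m} \<union> {n..<n + m} \<times> {u}"

lemma glue_iff:
  assumes "elimination_orientation n R" "(u, v) \<in> R"
  shows "(a, b) \<in> glue n R u v m S \<longleftrightarrow>
    (if a < n then if b < n then (a, b) \<in> R else a = v \<and> b < n + m
     else if b < n then b = u \<and> a < n + m else (a - n, b - n) \<in> S)"
proof -
  have "R \<subseteq> {..<n} \<times> {..<n}"
    using assms(1) by (simp add: elimination_orientation_def)
  moreover have "(a, b) \<in> (\<lambda>(a, b). (n + a, n + b)) ` S \<longleftrightarrow> n \<le> a \<and> n \<le> b \<and> (a - n, b - n) \<in> S"
    by (auto simp: image_iff intro!: bexI[of _ "(a - n, b - n)"])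
  ultimately show ?thesis
    using assms(2) by (auto simp: glue_def)
qed

text \<open>The smaller neighbours of a new vertex are \<open>u\<close>, \<open>v\<close> and
  vertices of the copy. The first two are joined by an arc, those in the copy form a clique by the
  hypothesis on \<open>S\<close>, and \<open>u\<close> and \<open>v\<close> are adjacent to the
  whole copy. Old vertices gain no smaller neighbours.\<close>

lemma elimination_orientation_glue:
  assumes R: "elimination_orientation n R" and uv: "(u, v) \<in> R"
    and S: "elimination_orientation m S"
  shows "elimination_orientation (n + m) (glue n R u v m S)"
proof -
  note iff = glue_iff[OF R uv]
  have R': "R \<subseteq> {..<n} \<times> {..<n}" and Ra: "\<And>a b. (a, b) \<in> R \<Longrightarrow> (b, a) \<notin> R"
    and Re: "\<And>a b c. a < c \<Longrightarrow> b < c \<Longrightarrow> a \<noteq> b \<Longrightarrow> adjacent R a c \<Longrightarrow> adjacent R b c \<Longrightarrow> adjacent R a b"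
    using R unfolding elimination_orientation_def by blast+
  have S': "S \<subseteq> {..<m} \<times> {..<m}" and Sa: "\<And>a b. (a, b) \<in> S \<Longrightarrow> (b, a) \<notin> S"
    and Se: "\<And>a b c. a < c \<Longrightarrow> b < c \<Longrightarrow> a \<noteq> b \<Longrightarrow> adjacent S a c \<Longrightarrow> adjacent S b c \<Longrightarrow> adjacent S a b"
    using S unfolding elimination_orientation_def by blast+
  have uvn: "u < n" "v < n" "u \<noteq> v"
    using uv R' Ra by auto
  let ?T = "glue n R u v m S"
  have T: "?T \<subseteq> {..<n + m} \<times> {..<n + m}"
    using R' S' uvn by (fastforce simp: glue_def)
  moreover have "(b, a) \<notin> ?T" if "(a, b) \<in> ?T" for a b
    using that uvn Ra Sa by (auto simp: iff split: if_splits)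
  moreover have "adjacent ?T a b"
    if "a < c" "b < c" "a \<noteq> b" "adjacent ?T a c" "adjacent ?T b c" for a b c
  proof (cases "c < n")
    case True
    then show ?thesis
      using that Re[of a c b] by (auto simp: adjacent_def iff)
  next
    case False
    have adj: "adjacent ?T d c \<longleftrightarrow> (if d < n then d \<in> {u, v} \<and> c < n + m else adjacent S (d - n) (c - n))"
      for d using False by (auto simp: adjacent_def iff)
    have less: "d < n + m" if "adjacent ?T d c" for d
      using that T unfolding adjacent_def by blast
    show ?thesis
    proof (cases "a < n \<or> b < n")
      case True
      moreover have "a < n \<longrightarrow> a = u \<or> a = v" "b < n \<longrightarrow> b = u \<or> b = v"
        using that adj[of a] adj[of b] by auto
      ultimately show ?thesis
        using uv \<open>a \<noteq> b\<close> less[OF \<open>adjacent ?T a c\<close>] less[OF \<open>adjacent ?T b c\<close>]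
        by (auto simp: adjacent_def iff split: if_splits)
    next
      case F: False
      then have "adjacent S (a - n) (b - n)"
        using that False adj[of a] adj[of b] Se[of "a - n" "c - n" "b - n"] by auto
      then show ?thesis
        using F by (auto simp: adjacent_def iff)
    qed
  qed
  ultimately show ?thesis
    unfolding elimination_orientation_def by blast
qed

lemma delta_free_glue:
  assumes R: "elimination_orientation n R" and uv: "(u, v) \<in> R"
    and R_free: "\<And>x a a' b b'. \<not> delta_in R x a a' b b'"
    and S_free: "\<And>x a a' b b'. \<not> delta_in S x a a' b b'"
  shows "\<not> delta_in (glue n R u v m S) x a a' b b'"
proof
  note iff = glue_iff[OF R uv]
  let ?T = "glue n R u v m S" and ?D = "{x, a, a', b, b'}"
  assume D: "delta_in ?T x a a' b b'"
  have uvn: "u < n" "v < n" "u \<noteq> v" "(v, u) \<notin> R" "(u, u) \<notin> R" "(v, v) \<notin> R"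
    using uv R unfolding elimination_orientation_def by auto
  consider "\<forall>w\<in>?D. w < n" | "\<forall>w\<in>?D. n \<le> w" | "\<exists>w\<in>?D. n \<le> w" "\<exists>w\<in>?D. w < n"
    by (meson not_le)
  then show False
  proof cases
    case 1
    then have "delta_in R x a a' b b'"
      using D by (simp add: delta_in_def iff)
    then show False using R_free by blast
  next
    case 2
    then have "delta_in S (x - n) (a - n) (a' - n) (b - n) (b' - n)"
      using D by (simp add: delta_in_def iff not_less[symmetric])
    then show False using S_free by blast
  next
    case 3
    \<comment> \<open>As \<open>\<Delta>(1,2,2)\<close> is a tournament, every old vertex of a mixed
      copy is adjacent to its new vertex \<open>w\<close>; only \<open>u\<close> and
      \<open>v\<close> have new neighbours.\<close>
    have adj: "adjacent ?T p q" if "p \<in> ?D" "q \<in> ?D" "p \<noteq> q" for p q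
      using D that unfolding delta_in_def adjacent_def by auto
    obtain w where w: "w \<in> ?D" "n \<le> w" using 3 by blast
    have low: "p \<in> {u, v}" if "p \<in> ?D" "p < n" for p
      using adj[of p w] that w by (auto simp: adjacent_def iff split: if_splits)
    have from_u: "q = v" if "(u, q) \<in> ?T" "q \<in> ?D" for q
      using that uvn low[of q] by (auto simp: iff split: if_splits)
    have to_v: "q = u" if "(q, v) \<in> ?T" "q \<in> ?D" for q
      using that uvn low[of q] by (auto simp: iff split: if_splits)
    have irr: "(q, q) \<notin> ?T" if "q \<in> {u, v}" for q
      using that uvn by (auto simp: iff)
    have "u \<in> ?D \<or> v \<in> ?D" using 3 low by blast
    moreover have arcs: "(a, a') \<in> ?T" "(b, b') \<in> ?T" "(x, a) \<in> ?T" "(x, a') \<in> ?T" "(a, b) \<in> ?T"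
      "(a, b') \<in> ?T" "(a', b) \<in> ?T" "(a', b') \<in> ?T" "(b, x) \<in> ?T" "(b', x) \<in> ?T"
      using D by (simp_all add: delta_in_def)
    \<comment> \<open>Each vertex other than \<open>a\<close> has two in-neighbours joined by an
      arc, and \<open>to_v\<close> would make both equal to \<open>u\<close>. If
      \<open>v = a\<close>, then \<open>x = u\<close>, and \<open>from_u\<close> makes its other
      out-neighbour \<open>a'\<close> equal to \<open>v\<close> as well.\<close>
    have v: "v \<notin> ?D"
    proof
      assume "v \<in> ?D"
      then consider "v = x" | "v = a" | "v = a'" | "v = b" | "v = b'" by blast
      then show False
      proof cases
        case 1
        then have "b = u" "b' = u" using to_v[of b] to_v[of b'] arcs by simp_all
        then show ?thesis using arcs(2) irr by simp
      next
        case 2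
        then have "x = u" using to_v[of x] arcs by simp
        then have "a' = v" using from_u[of a'] arcs by simp
        then show ?thesis using 2 arcs(1) irr by simp
      next
        case 3
        then have "x = u" "a = u" using to_v[of x] to_v[of a] arcs by simp_all
        then show ?thesis using arcs(3) irr by simp
      next
        case 4
        then have "a = u" "a' = u" using to_v[of a] to_v[of a'] arcs by simp_all
        then show ?thesis using arcs(1) irr by simp
      next
        case 5
        then have "a = u" "b = u" using to_v[of a] to_v[of b] arcs by simp_all
        then show ?thesis using arcs(5) irr by simp
      qed
    qed
    \<comment> \<open>\<open>\<Delta>(1,2,2)\<close> has no sink, and the only out-neighbour left
      for \<open>u\<close> is the excluded \<open>v\<close>.\<close>
    moreover have "u \<notin> ?D"
    proof
      assume "u \<in> ?D"
      then have "\<exists>q\<in>?D. (u, q) \<in> ?T" using arcs by auto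
      then show False using from_u v by blast
    qed
    ultimately show False by blast
  qed
qed

lemma mono_triangle_glue:
  assumes R: "elimination_orientation n R" and uv: "(u, v) \<in> R" and "f u = f v"
    and card: "card (f ` {..<n + m}) \<le> Suc k"
    and S: "\<And>g :: nat \<Rightarrow> 'c. card (g ` {..<m}) \<le> k \<Longrightarrow> mono_triangle S g"
  shows "mono_triangle (glue n R u v m S) (f :: nat \<Rightarrow> 'c)"
proof (cases "\<exists>w\<in>{n..<n + m}. f w = f u")
  case True
  then obtain w where w: "w \<in> {n..<n + m}" "f w = f u" by blast
  then have "(u, v) \<in> glue n R u v m S" "(v, w) \<in> glue n R u v m S" "(w, u) \<in> glue n R u v m S"
    using uv by (auto simp: glue_def)
  then show ?thesis
    using w(2) \<open>f u = f v\<close> unfolding mono_triangle_def by metis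
next
  case False
  have "u < n"
    using R uv unfolding elimination_orientation_def by auto
  let ?g = "\<lambda>x. f (n + x)"
  \<comment> \<open>The copy avoids the colour of \<open>u\<close>, which is one of the at most
    \<open>Suc k\<close> colours counted because \<open>u < n\<close>; hence at most
    \<open>k\<close> remain for the copy.\<close>
  have "?g ` {..<m} \<subseteq> f ` {..<n + m} - {f u}"
    using False by fastforce
  then have "card (?g ` {..<m}) \<le> card (f ` {..<n + m} - {f u})"
    by (intro card_mono) auto
  also have "\<dots> \<le> k"
    using \<open>u < n\<close> card by (subst card_Diff_singleton) auto
  finally have "mono_triangle S ?g"
    by (rule S)
  moreover have "(n + a, n + b) \<in> glue n R u v m S" if "(a, b) \<in> S" for a b
    using that by (force simp: glue_def)
  ultimately show ?thesis
    unfolding mono_triangle_def by blast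
qed

section \<open>Iterating the gluing over the arcs of a transitive tournament\<close>

lemma exists_delta_free_forcing_mono_triangle:
  "\<exists>n R. elimination_orientation n R \<and> (\<forall>x a a' b b'. \<not> delta_in R x a a' b b') \<and>
     (\<forall>f :: nat \<Rightarrow> 'c. card (f ` {..<n}) \<le> k \<longrightarrow> mono_triangle R f)"
proof (induction k)
  case 0
  \<comment> \<open>A single vertex already uses one colour, so the claim for no colours is
    vacuous.\<close>
  show ?case
    by (rule exI[of _ 1], rule exI[of _ "{}"])
      (auto simp: elimination_orientation_def delta_in_def adjacent_def)
next
  case (Suc k)
  then obtain m S where S: "elimination_orientation m S" "\<And>x a a' b b'. \<not> delta_in S x a a' b b'"
    "\<And>f :: nat \<Rightarrow> 'c. card (f ` {..<m}) \<le> k \<Longrightarrow> mono_triangle S f"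
    by blast
  define T where "T = {(i, j). i < j \<and> j < Suc (Suc k)}"
  have "T \<subseteq> {..<Suc (Suc k)} \<times> {..<Suc (Suc k)}"
    by (auto simp: T_def)
  then have "finite T"
    by (rule finite_subset) auto
  \<comment> \<open>The arcs of the tournament \<open>T\<close> are treated one at a time.
    \<open>F\<close> holds those that already have their copy of \<open>S\<close>; keeping
    \<open>T \<subseteq> R\<close> ensures that the next arc is still present to be glued
    onto.\<close>
  have "\<exists>n R. elimination_orientation n R \<and> (\<forall>x a a' b b'. \<not> delta_in R x a a' b b') \<and>
      T \<subseteq> R \<and> Suc (Suc k) \<le> n \<and>
      (\<forall>f :: nat \<Rightarrow> 'c. card (f ` {..<n}) \<le> Suc k \<longrightarrow> (\<exists>(i, j)\<in>F. f i = f j) \<longrightarrow> mono_triangle R f)"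
    if "finite F" "F \<subseteq> T" for F
    using that
  proof (induction F rule: finite_induct)
    case empty
    have "elimination_orientation (Suc (Suc k)) T"
      by (auto simp: elimination_orientation_def T_def adjacent_def)
    moreover have "\<not> delta_in T x a a' b b'" for x a a' b b'
      by (auto simp: delta_in_def T_def)
    ultimately show ?case by blast
  next
    case (insert e F)
    obtain u v where e: "e = (u, v)" by fastforce
    obtain n R where R: "elimination_orientation n R" "\<And>x a a' b b'. \<not> delta_in R x a a' b b'"
      "T \<subseteq> R" "Suc (Suc k) \<le> n"
      and F: "\<And>f :: nat \<Rightarrow> 'c. card (f ` {..<n}) \<le> Suc k \<Longrightarrow> \<exists>(i, j)\<in>F. f i = f j \<Longrightarrow> mono_triangle R f"
      using insert.IH insert.prems by auto
    have uv: "(u, v) \<in> R"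
      using insert.prems R(3) e by auto
    let ?T = "glue n R u v m S"
    have "mono_triangle ?T f"
      if f: "card (f ` {..<n + m}) \<le> Suc k" and ex: "\<exists>(i, j)\<in>insert e F. f i = f j" for f :: "nat \<Rightarrow> 'c"
    proof (cases "f u = f v")
      case True
      then show ?thesis
        by (rule mono_triangle_glue[OF R(1) uv _ f S(3)])
    next
      case False
      \<comment> \<open>The equal-coloured arc was treated earlier: on the old vertices
        \<open>f\<close> uses no more colours, and gluing keeps all old arcs.\<close>
      have "card (f ` {..<n}) \<le> card (f ` {..<n + m})"
        by (intro card_mono image_mono) auto
      then have "mono_triangle R f"
        using f ex False e by (intro F) auto
      then show ?thesis
        unfolding mono_triangle_def glue_def by blast
    qed
    moreover have "T \<subseteq> ?T" "Suc (Suc k) \<le> n + m"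
      using R(3,4) by (auto simp: glue_def)
    ultimately show ?case
      using elimination_orientation_glue[OF R(1) uv S(1)] delta_free_glue[OF R(1) uv R(2) S(2)]
      by blast
  qed
  from this[OF \<open>finite T\<close> order.refl] obtain n R where
    R: "elimination_orientation n R" "\<And>x a a' b b'. \<not> delta_in R x a a' b b'" "Suc (Suc k) \<le> n"
    and T: "\<And>f :: nat \<Rightarrow> 'c. card (f ` {..<n}) \<le> Suc k \<Longrightarrow> \<exists>(i, j)\<in>T. f i = f j \<Longrightarrow> mono_triangle R f"
    by auto
  have "mono_triangle R f" if f: "card (f ` {..<n}) \<le> Suc k" for f :: "nat \<Rightarrow> 'c"
  proof -
    \<comment> \<open>Pigeonhole on the \<open>k + 2\<close> tournament vertices, which are among
      the \<open>n\<close> coloured ones.\<close>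
    have "card (f ` {..<Suc (Suc k)}) \<le> card (f ` {..<n})"
      using R(3) by (intro card_mono image_mono) auto
    then have "\<not> inj_on f {..<Suc (Suc k)}"
      using f by (intro pigeonhole) simp
    then obtain i j where ij: "i < Suc (Suc k)" "j < Suc (Suc k)" "i \<noteq> j" "f i = f j"
      by (auto simp: inj_on_def)
    then have "\<exists>(i, j)\<in>T. f i = f j"
      unfolding T_def by (auto, metis linorder_neqE_nat)
    with T f show ?thesis by blast
  qed
  with R(1,2) show ?case by blast
qed

section \<open>From induced copies to relations: chordality and \<open>Delta_1_2_2\<close>\<close>

text \<open>Arcs here are pairs of vertices, so the arc map of an isomorphism is determined by its
  vertex map. The embedding \<open>g\<close> is the inverse of that vertex map.\<close>

lemma has_induced_copy_embedding:
  assumes "has_induced_copy (with_proj X) (with_proj H)"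
  obtains g where "inj_on g (pverts H)" "g ` pverts H \<subseteq> pverts X"
    "\<And>x y. x \<in> pverts H \<Longrightarrow> y \<in> pverts H \<Longrightarrow> (x, y) \<in> parcs H \<longleftrightarrow> (g x, g y) \<in> parcs X"
proof -
  obtain K where K: "induced_subgraph K (with_proj X)" and "digraph_iso K (with_proj H)"
    using assms unfolding has_induced_copy_def by blast
  then obtain h where h: "pre_digraph.digraph_isomorphism K h" and H: "with_proj H = app_iso h K"
    unfolding digraph_iso_def by blast
  have tK: "tail K = fst" "head K = snd" and sub: "verts K \<subseteq> pverts X"
    and arcs: "arcs K = {e \<in> parcs X. fst e \<in> verts K \<and> snd e \<in> verts K}"
    using K unfolding induced_subgraph_def subgraph_def compatible_def by auto
  have vH: "pverts H = iso_verts h ` verts K" and aH: "parcs H = iso_arcs h ` arcs K"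
    and tH: "iso_tail h = fst" and hH: "iso_head h = snd"
    using arg_cong[OF H, of verts] arg_cong[OF H, of pre_digraph.arcs]
      arg_cong[OF H, of tail] arg_cong[OF H, of head] by simp_all
  have inj: "inj_on (iso_verts h) (verts K)"
    and ends: "\<And>e. e \<in> arcs K \<Longrightarrow> iso_arcs h e = (iso_verts h (fst e), iso_verts h (snd e))"
    using h unfolding pre_digraph.digraph_isomorphism_def by (auto simp: tK tH hH prod_eq_iff)
  have mem: "(iso_verts h p, iso_verts h q) \<in> parcs H \<longleftrightarrow> (p, q) \<in> parcs X"
    if "p \<in> verts K" "q \<in> verts K" for p q
  proof
    assume "(iso_verts h p, iso_verts h q) \<in> parcs H"
    then obtain e where e: "e \<in> arcs K" "(iso_verts h p, iso_verts h q) = iso_arcs h e"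
      using aH by auto
    then have "p = fst e" "q = snd e"
      using that ends[OF e(1)] inj arcs by (auto dest: inj_onD)
    then show "(p, q) \<in> parcs X" using e(1) arcs by auto
  next
    assume "(p, q) \<in> parcs X"
    then have "(p, q) \<in> arcs K" using that arcs by auto
    then show "(iso_verts h p, iso_verts h q) \<in> parcs H"
      using ends[of "(p, q)"] aH by force
  qed
  show thesis
  proof (rule that[of "the_inv_into (verts K) (iso_verts h)"])
    show "inj_on (the_inv_into (verts K) (iso_verts h)) (pverts H)"
      using inj vH by (simp add: inj_on_the_inv_into)
    show "the_inv_into (verts K) (iso_verts h) ` pverts H \<subseteq> pverts X"
      using inj vH sub by (auto simp: the_inv_into_f_f)
    fix x y assume "x \<in> pverts H" "y \<in> pverts H"
    then show "(x, y) \<in> parcs H \<longleftrightarrow>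
      (the_inv_into (verts K) (iso_verts h) x, the_inv_into (verts K) (iso_verts h) y) \<in> parcs X"
      using vH mem inj by (auto simp: the_inv_into_f_f)
  qed
qed

text \<open>The largest vertex of an induced cycle of length at least 4 would have two smaller
  non-adjacent neighbours.\<close>

lemma no_induced_cycle:
  assumes R: "elimination_orientation n R" and "4 \<le> l"
  shows "\<not> has_induced_copy (with_proj \<lparr>pverts = {..<n}, parcs = R \<union> R\<inverse>\<rparr>) (with_proj (cycle_graph l))"
proof
  assume "has_induced_copy (with_proj \<lparr>pverts = {..<n}, parcs = R \<union> R\<inverse>\<rparr>) (with_proj (cycle_graph l))"
  then obtain g where inj: "inj_on g {..<l}" and
    g: "\<And>x y. x < l \<Longrightarrow> y < l \<Longrightarrow> (x, y) \<in> parcs (cycle_graph l) \<longleftrightarrow> adjacent R (g x) (g y)"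
    by (rule has_induced_copy_embedding) (auto simp: cycle_graph_def adjacent_def)
  have "Max (g ` {..<l}) \<in> g ` {..<l}"
    using \<open>4 \<le> l\<close> by (intro Max_in) (auto simp: lessThan_empty_iff)
  then obtain i where i: "i < l" "Max (g ` {..<l}) = g i" by auto
  have less: "g j < g i" if "j < l" "j \<noteq> i" for j
  proof -
    have "g j \<le> g i" using that i by (metis Max_ge finite_imageI finite_lessThan imageI lessThan_iff)
    moreover have "g j \<noteq> g i" using that i inj by (auto dest: inj_onD)
    ultimately show ?thesis by simp
  qed
  \<comment> \<open>These are the two neighbours of \<open>i\<close> on the cycle, with the
    wrap-around at both ends made explicit. They are distinct and non-adjacent because
    \<open>l \<ge> 4\<close>.\<close>
  define a b where "a = (if Suc i = l then 0 else Suc i)" and "b = (if i = 0 then l - 1 else i - 1)"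
  have ab: "a < l" "b < l" "a \<noteq> i" "b \<noteq> i" "a \<noteq> b"
    using i \<open>4 \<le> l\<close> by (auto simp: a_def b_def)
  have "(a, i) \<in> parcs (cycle_graph l)" "(b, i) \<in> parcs (cycle_graph l)"
    using ab i \<open>4 \<le> l\<close> by (auto simp: cycle_graph_def a_def b_def)
  then have "adjacent R (g a) (g i)" "adjacent R (g b) (g i)"
    using g ab i by auto
  moreover have "g a \<noteq> g b"
    using inj ab by (auto dest: inj_onD)
  ultimately have "adjacent R (g a) (g b)"
    using R less ab unfolding elimination_orientation_def by blast
  then have "(a, b) \<in> parcs (cycle_graph l)"
    using g ab by auto
  then show False
    using i \<open>4 \<le> l\<close> by (auto simp: cycle_graph_def a_def b_def mod_Suc split: if_splits)
qed

lemma chordal_orientation_elimination: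
  assumes R: "elimination_orientation n R"
  shows "chordal_orientation (with_proj \<lparr>pverts = {..<n}, parcs = R\<rparr>)"
proof -
  let ?P = "\<lparr>pverts = {..<n}, parcs = R\<rparr>" and ?U = "\<lparr>pverts = {..<n}, parcs = R \<union> R\<inverse>\<rparr>"
  have R': "R \<subseteq> {..<n} \<times> {..<n}" and Ra: "\<And>a b. (a, b) \<in> R \<Longrightarrow> (b, a) \<notin> R"
    using R unfolding elimination_orientation_def by blast+
  then have Ri: "(a, a) \<notin> R" for a by blast
  have "finite R"
    using R' by (rule finite_subset) auto
  then have "simple_digraph (with_proj ?P)"
    using R' Ra Ri by unfold_locales (auto simp: arc_to_ends_def)
  moreover have "mk_symmetric (with_proj ?P) = ?U"
    by (auto simp: mk_symmetric_def)
  moreover have "graph (with_proj ?U)"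
    using R' Ri \<open>finite R\<close>
    by unfold_locales (auto simp: arc_to_ends_def Digraph.symmetric_def sym_def)
  ultimately show ?thesis
    using no_induced_cycle[OF R] unfolding chordal_orientation_def chordal_graph_def by auto
qed

lemma no_induced_Delta_1_2_2:
  assumes "\<And>x a a' b b'. \<not> delta_in R x a a' b b'"
  shows "\<not> has_induced_copy (with_proj \<lparr>pverts = V, parcs = R\<rparr>) (with_proj Delta_1_2_2)"
proof
  assume "has_induced_copy (with_proj \<lparr>pverts = V, parcs = R\<rparr>) (with_proj Delta_1_2_2)"
  then obtain g where g: "\<And>x y. x \<in> pverts Delta_1_2_2 \<Longrightarrow> y \<in> pverts Delta_1_2_2 \<Longrightarrow>
      (x, y) \<in> parcs Delta_1_2_2 \<longleftrightarrow> (g x, g y) \<in> R"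
    using has_induced_copy_embedding by (metis pair_pre_digraph.select_convs(2))
  have arc: "(g x, g y) \<in> R" if "(x, y) \<in> parcs Delta_1_2_2" for x y
    using that g[of x y] by (auto simp: Delta_1_2_2_def)
  have "delta_in R (g 0) (g 1) (g 2) (g 3) (g 4)"
    unfolding delta_in_def insert_subset
    by (intro conjI arc empty_subsetI) (simp_all add: Delta_1_2_2_def)
  with assms show False by blast
qed

section \<open>Partitions into acyclic parts and the dichromatic number\<close>

lemma cyclic_triangle_not_acyclic:
  assumes "irrefl R" "{a, b, c} \<subseteq> S" "(a, b) \<in> R" "(b, c) \<in> R" "(c, a) \<in> R"
  shows "\<not> acyclic_digraph (with_proj \<lparr>pverts = V, parcs = R\<rparr> \<restriction> S)"
proof -
  let ?G = "with_proj \<lparr>pverts = V, parcs = R\<rparr> \<restriction> S"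
  \<comment> \<open>The notion \<open>cycle\<close> asks for distinct vertices along the
    walk.\<close>
  have "a \<noteq> b" "b \<noteq> c" "c \<noteq> a"
    using assms by (auto simp: irrefl_def)
  then have "pre_digraph.cycle ?G [(a, b), (b, c), (c, a)]"
    using assms
    by (auto simp: pre_digraph.cycle_def pre_digraph.awalk_def pre_digraph.cas.simps
        pre_digraph.awalk_verts.simps)
  then show ?thesis
    unfolding acyclic_digraph_def by blast
qed

lemma acyclic_singleton:
  assumes "loopfree_digraph G"
  shows "acyclic_digraph (G \<restriction> {v})"
proof -
  have "arcs (G \<restriction> {v}) = {}"
    using loopfree_digraph.no_loops[OF assms] by force
  then show ?thesis
    unfolding acyclic_digraph_def pre_digraph.cycle_def pre_digraph.awalk_def by (metis set_empty subset_empty)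
qed

text \<open>The minimum in \<open>dichromatic_number\<close> is attained, since without loops the
  partition into singletons qualifies.\<close>

lemma dichromatic_number_partition:
  assumes "fin_digraph G" "loopfree_digraph G"
  obtains P where "partition_on (verts G) P" "finite P" "card P = dichromatic_number G"
    "\<And>S. S \<in> P \<Longrightarrow> acyclic_digraph (G \<restriction> S)"
proof -
  let ?Q = "\<lambda>k. \<exists>P. partition_on (verts G) P \<and> finite P \<and> card P = k \<and>
     (\<forall>S\<in>P. acyclic_digraph (G \<restriction> S))"
  let ?P = "(\<lambda>v. {v}) ` verts G"
  have "partition_on (verts G) ?P"
    by (auto simp: partition_on_def disjoint_def)
  then have "?Q (card ?P)"
    using fin_digraph.finite_verts[OF assms(1)] acyclic_singleton[OF assms(2)] by blast
  then have "?Q (dichromatic_number G)"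
    unfolding dichromatic_number_def by (rule LeastI)
  then show thesis using that by blast
qed

text \<open>Colour each vertex by its part in an optimal partition. With at most \<open>k\<close>
  parts a monochromatic cyclic triangle would lie inside one acyclic part. Colours are therefore
  sets of vertices.\<close>

lemma dichromatic_number_greater:
  assumes R: "elimination_orientation n R"
    and mono: "\<And>f :: nat \<Rightarrow> nat set. card (f ` {..<n}) \<le> k \<Longrightarrow> mono_triangle R f"
  shows "k < dichromatic_number (with_proj \<lparr>pverts = {..<n}, parcs = R\<rparr>)"
proof (rule ccontr)
  let ?G = "with_proj \<lparr>pverts = {..<n}, parcs = R\<rparr>"
  assume "\<not> k < dichromatic_number ?G"
  then have le: "dichromatic_number ?G \<le> k" by simp
  interpret simple_digraph ?G
    using chordal_orientation_elimination[OF R] unfolding chordal_orientation_def by blast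
  obtain P where P: "partition_on (verts ?G) P" "finite P" "card P = dichromatic_number ?G"
    "\<And>S. S \<in> P \<Longrightarrow> acyclic_digraph (?G \<restriction> S)"
    using dichromatic_number_partition fin_digraph_axioms loopfree_digraph_axioms by blast
  \<comment> \<open>For \<open>v \<ge> n\<close> the value is arbitrary; only colours of vertices
    below \<open>n\<close> are counted, and all arcs of \<open>R\<close> lie there.\<close>
  define f where "f v = (SOME S. S \<in> P \<and> v \<in> S)" for v
  have f: "f v \<in> P \<and> v \<in> f v" if "v < n" for v
    unfolding f_def by (rule someI_ex) (use P(1) that in \<open>auto simp: partition_on_def\<close>)
  have "card (f ` {..<n}) \<le> card P"
    using f P(2) by (intro card_mono) auto
  then have "mono_triangle R f"
    using P(3) le by (intro mono) simp
  then obtain a b c where abc: "(a, b) \<in> R" "(b, c) \<in> R" "(c, a) \<in> R" "f a = f b" "f b = f c"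
    unfolding mono_triangle_def by blast
  then have "a < n" "b < n" "c < n" "irrefl R"
    using R unfolding elimination_orientation_def irrefl_def by blast+
  then have "{a, b, c} \<subseteq> f a" "f a \<in> P"
    using f[of a] f[of b] f[of c] abc by auto
  with cyclic_triangle_not_acyclic[OF \<open>irrefl R\<close> _ abc(1-3)] P(4) show False
    by blast
qed

theorem theorem2p6:
  shows "\<not> hero_in (with_proj Delta_1_2_2)
            {G :: (nat, nat \<times> nat) pre_digraph. chordal_orientation G}
       \<and> (\<forall>k::int. \<exists>G :: (nat, nat \<times> nat) pre_digraph.
            chordal_orientation G
            \<and> \<not> has_induced_copy G (with_proj Delta_1_2_2)
            \<and> int (dichromatic_number G) > k)"
proof -
  have ex: "\<exists>G :: (nat, nat \<times> nat) pre_digraph. chordal_orientation G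
      \<and> \<not> has_induced_copy G (with_proj Delta_1_2_2) \<and> dichromatic_number G > k" for k
  proof -
    obtain n R where R: "elimination_orientation n R" "\<And>x a a' b b'. \<not> delta_in R x a a' b b'"
      and mono: "\<And>f :: nat \<Rightarrow> nat set. card (f ` {..<n}) \<le> k \<Longrightarrow> mono_triangle R f"
      using exists_delta_free_forcing_mono_triangle[where 'c = "nat set"] by blast
    show ?thesis
      using chordal_orientation_elimination[OF R(1)] no_induced_Delta_1_2_2[OF R(2)]
        dichromatic_number_greater[OF R(1) mono] by blast
  qed
  have "\<not> hero_in (with_proj Delta_1_2_2)
      {G :: (nat, nat \<times> nat) pre_digraph. chordal_orientation G}"
    using ex unfolding hero_in_def by (auto simp: not_le)
  moreover have "\<exists>G :: (nat, nat \<times> nat) pre_digraph. chordal_orientation G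
      \<and> \<not> has_induced_copy G (with_proj Delta_1_2_2) \<and> int (dichromatic_number G) > k" for k :: int
  proof -
    \<comment> \<open>For negative \<open>k\<close> the bound \<open>nat k\<close> is 0, which still
      exceeds \<open>k\<close>.\<close>
    obtain G :: "(nat, nat \<times> nat) pre_digraph" where "chordal_orientation G"
      "\<not> has_induced_copy G (with_proj Delta_1_2_2)" "nat k < dichromatic_number G"
      using ex[of "nat k"] by blast
    moreover from this(3) have "k < int (dichromatic_number G)"
      by linarith
    ultimately show ?thesis by blast
  qed
  ultimately show ?thesis by blast
qed

end
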